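(* Let $(X,\sigma)$ be a Deaconu-Renault system on the metric space $(X,d)$. Then the topological entropy is bounded above by the metric entropy: $h(\sigma)\leq h_d(\sigma)$.
   Context: $\mathbb N=\{1,2,\dots\}$. A Deaconu-Renault system is a pair $(X,\sigma)$ with $X$ a locally compact Hausdorff space and $\sigma:Dom(\sigma)\to Im(\sigma)$ a local homeomorphism from an open set $Dom(\sigma)\subseteq X$ onto an open set $Im(\sigma)\subseteq X$; here the topology of $X$ is the one given by the metric $d$. Put $Dom(\sigma^0)=X$, $\sigma^0=\mathrm{id}$, and inductively $Dom(\sigma^n)=\sigma^{-1}(Dom(\sigma^{n-1}))$, with $\sigma^n$ the $n$-fold composition, defined on $Dom(\sigma^n)$. Metric entropy. For $n\in\mathbb N$, $x\in X$ let $I_n(x)=\{i\in\{0,\dots,n-1\}:x\in Dom(\sigma^i)\}$ and $d_n(x,y)=\max_{i\in I_n(x)\cap I_n(y)}d(\sigma^i(x),\sigma^i(y))$. For $K\subseteq X$ compact, $Y\subseteq X$ and $\varepsilon>0$, a set $A\subseteq K\cap Y$ is $(n,\varepsilon,\sigma,K\cap Y)$-separated if $d_n(x,y)>\varepsilon$ for all distinct $x,y\in A$; $sep(n,\varepsilon,\sigma,K\cap Y)$ is the largest cardinality of such a set. Let $ssep(n,\varepsilon,\sigma,K)=\sup_F sep(n,\varepsilon,\sigma,K\cap F)$, the supremum being over all closed subsets $F$ of $X$ with $F\subseteq Dom(\sigma^{n-1})$. Define $h_\varepsilon(\sigma,K,d)=\limsup_{n\to\infty}\frac1n\log ssep(n,\varepsilon,\sigma,K)$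 (a limsup of a sequence in the extended reals $\mathbb R\cup\{-\infty,\infty\}$, where $\frac1n\log ssep(n,\varepsilon,\sigma,K)$ is set to be $\infty$ if $ssep(n,\varepsilon,\sigma,K)=\infty$), $h_d(\sigma,K)=\lim_{\varepsilon\to0}h_\varepsilon(\sigma,K,d)$, and the metric entropy $h_d(\sigma)=\sup_K h_d(\sigma,K)$ over all compact $K\subseteq X$. Topological entropy (via covers). For families $\alpha,\beta$ of subsets of $X$ let $\alpha\vee\beta=\{A\cap B:A\in\alpha,B\in\beta\}$ and $\sigma^{-i}(\alpha)=\{\sigma^{-i}(A):A\in\alpha\}$, where $\sigma^{-i}(A)=\{x\in Dom(\sigma^i):\sigma^i(x)\in A\}$. For $Y\subseteq X$ a cover of $Y$ is a family of subsets of $X$ whose union contains $Y$; an open cover consists of open subsets of $X$. For a cover $\alpha$ of $Y$ and $n\in\mathbb N$ let $\alpha_n=\alpha\vee\sigma^{-1}(\alpha)\vee\dots\vee\sigma^{-n}(\alpha)$, which is a cover of $Y_n=Y\cap\sigma^{-1}(Y)\cap\dots\cap\sigma^{-n}(Y)$. $N(\alpha,Y)$ is the smallest cardinality of a subfamily of $\alpha$ covering $Y$ (with $N=1$ when the set to be covered is empty), and $H(\alpha,Y)=\log N(\alpha,Y)$ ($\infty$ if $N(\alpha,Y)=\infty$). For compact $K\subseteq X$ and an open cover $\alpha$ of $K$, $h(\alpha,\sigma,K)=\lim_{n\to\infty}\frac1nH(\alpha_n,K_n)$ (this limit exists); $h(\sigma,K)=\sup_\alpha h(\alpha,\sigma,K)$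 over open covers $\alpha$ of $K$; the topological entropy is $h(\sigma)=\sup_K h(\sigma,K)$ over compact $K\subseteq X$.
   Formalization: In the metric entropy, log ssep is taken to be 0 (not −∞) when ssep = 0; with log 0 = −∞ the claim fails, e.g. for X a point and Dom(σ) empty, where h(σ) = 0 but h_d(σ) = −∞, and h_d(σ) is unchanged whenever it is not −∞. *)

theory Defs
  imports "HOL-Analysis.Analysis"
begin

text \<open>
  The space \<open>X\<close> is the universe of a type of class \<^class>\<open>metric_space\<close>, with \<open>d\<close> = \<^const>\<open>dist\<close>.
  The partial map \<open>\<sigma>\<close> is a total function together with its domain \<open>D\<close>; no definition below looks at
  the values of \<open>\<sigma>\<close> outside \<open>D\<close>.
\<close>

definition local_homeomorphism_on :: "'a::topological_space set \<Rightarrow> ('a \<Rightarrow> 'a) \<Rightarrow> bool" where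
  "local_homeomorphism_on D \<sigma> \<longleftrightarrow>
     (\<forall>x\<in>D. \<exists>U V \<tau>. x \<in> U \<and> U \<subseteq> D \<and> openin (top_of_set D) U \<and>
        openin (top_of_set (\<sigma> ` D)) V \<and> homeomorphism U V \<sigma> \<tau>)"

definition deaconu_renault :: "'a::metric_space set \<Rightarrow> ('a \<Rightarrow> 'a) \<Rightarrow> bool" where
  "deaconu_renault D \<sigma> \<longleftrightarrow>
     locally_compact_space (euclidean :: 'a topology) \<and>
     open D \<and> open (\<sigma> ` D) \<and> local_homeomorphism_on D \<sigma>"

fun Dom_iter :: "'a set \<Rightarrow> ('a \<Rightarrow> 'a) \<Rightarrow> nat \<Rightarrow> 'a set" where
  "Dom_iter D \<sigma> 0 = UNIV"
| "Dom_iter D \<sigma> (Suc n) = {x \<in> D. \<sigma> x \<in> Dom_iter D \<sigma> n}"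

definition preimg :: "'a set \<Rightarrow> ('a \<Rightarrow> 'a) \<Rightarrow> nat \<Rightarrow> 'a set \<Rightarrow> 'a set" where
  "preimg D \<sigma> i A = {x \<in> Dom_iter D \<sigma> i. (\<sigma> ^^ i) x \<in> A}"

definition ecard :: "'b set \<Rightarrow> enat" where
  "ecard A = (if finite A then enat (card A) else \<infinity>)"

text \<open>
  Logarithm of a cardinality, with the convention \<open>log 0 = 0\<close>. A covering number is never \<open>0\<close> (it is
  \<open>1\<close> for the empty set), so the convention only matters for \<open>ssep\<close>, which is \<open>0\<close> exactly when \<open>K\<close>
  does not meet the domain of \<open>\<sigma>\<^sup>n\<^sup>-\<^sup>1\<close>; the empty set then contributes \<open>0\<close> to both entropies. With
  \<open>log 0 = -\<infinity>\<close> instead, the metric entropy would be unchanged unless it became \<open>-\<infinity>\<close> (e.g. for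
  \<open>D = {}\<close>), whereas the topological entropy is always nonnegative.
\<close>
definition elog :: "enat \<Rightarrow> ereal" where
  "elog N = (case N of enat k \<Rightarrow> if k = 0 then 0 else ereal (ln (real k)) | \<infinity> \<Rightarrow> \<infinity>)"

subsection \<open>Metric entropy\<close>

definition I_set :: "'a set \<Rightarrow> ('a \<Rightarrow> 'a) \<Rightarrow> nat \<Rightarrow> 'a \<Rightarrow> nat set" where
  "I_set D \<sigma> n x = {i. i < n \<and> x \<in> Dom_iter D \<sigma> i}"

text \<open>Meaningful for \<open>n \<ge> 1\<close>, where the index set contains \<open>0\<close>. Below, the value at \<open>n = 0\<close> of a
  sequence in \<open>n\<close> is irrelevant, since only its behaviour as \<open>n \<rightarrow> \<infinity>\<close> is used.\<close>
definition dist_n :: "'a::metric_space set \<Rightarrow> ('a \<Rightarrow> 'a) \<Rightarrow> nat \<Rightarrow> 'a \<Rightarrow> 'a \<Rightarrow> real" where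
  "dist_n D \<sigma> n x y =
     Max ((\<lambda>i. dist ((\<sigma> ^^ i) x) ((\<sigma> ^^ i) y)) ` (I_set D \<sigma> n x \<inter> I_set D \<sigma> n y))"

definition separated_set ::
  "'a::metric_space set \<Rightarrow> ('a \<Rightarrow> 'a) \<Rightarrow> nat \<Rightarrow> real \<Rightarrow> 'a set \<Rightarrow> 'a set \<Rightarrow> bool" where
  "separated_set D \<sigma> n \<epsilon> Z A \<longleftrightarrow>
     A \<subseteq> Z \<and> (\<forall>x\<in>A. \<forall>y\<in>A. x \<noteq> y \<longrightarrow> dist_n D \<sigma> n x y > \<epsilon>)"

definition sep :: "'a::metric_space set \<Rightarrow> ('a \<Rightarrow> 'a) \<Rightarrow> nat \<Rightarrow> real \<Rightarrow> 'a set \<Rightarrow> enat" where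
  "sep D \<sigma> n \<epsilon> Z = (SUP A\<in>{A. separated_set D \<sigma> n \<epsilon> Z A}. ecard A)"

definition ssep :: "'a::metric_space set \<Rightarrow> ('a \<Rightarrow> 'a) \<Rightarrow> nat \<Rightarrow> real \<Rightarrow> 'a set \<Rightarrow> enat" where
  "ssep D \<sigma> n \<epsilon> K =
     (SUP F\<in>{F. closed F \<and> F \<subseteq> Dom_iter D \<sigma> (n - 1)}. sep D \<sigma> n \<epsilon> (K \<inter> F))"

definition metric_entropy_eps ::
  "'a::metric_space set \<Rightarrow> ('a \<Rightarrow> 'a) \<Rightarrow> real \<Rightarrow> 'a set \<Rightarrow> ereal" where
  "metric_entropy_eps D \<sigma> \<epsilon> K =
     limsup (\<lambda>n. ereal (1 / real n) * elog (ssep D \<sigma> n \<epsilon> K))"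

definition metric_entropy_on :: "'a::metric_space set \<Rightarrow> ('a \<Rightarrow> 'a) \<Rightarrow> 'a set \<Rightarrow> ereal" where
  "metric_entropy_on D \<sigma> K = Lim (at_right 0) (\<lambda>\<epsilon>. metric_entropy_eps D \<sigma> \<epsilon> K)"

definition metric_entropy :: "'a::metric_space set \<Rightarrow> ('a \<Rightarrow> 'a) \<Rightarrow> ereal" where
  "metric_entropy D \<sigma> = (SUP K\<in>{K. compact K}. metric_entropy_on D \<sigma> K)"

subsection \<open>Topological entropy\<close>

definition cover_join :: "'a set set \<Rightarrow> 'a set set \<Rightarrow> 'a set set" where
  "cover_join \<alpha> \<beta> = {A \<inter> B | A B. A \<in> \<alpha> \<and> B \<in> \<beta>}"

fun cover_iter :: "'a set \<Rightarrow> ('a \<Rightarrow> 'a) \<Rightarrow> 'a set set \<Rightarrow> nat \<Rightarrow> 'a set set" where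
  "cover_iter D \<sigma> \<alpha> 0 = \<alpha>"
| "cover_iter D \<sigma> \<alpha> (Suc n) = cover_join (cover_iter D \<sigma> \<alpha> n) (preimg D \<sigma> (Suc n) ` \<alpha>)"

definition set_iter :: "'a set \<Rightarrow> ('a \<Rightarrow> 'a) \<Rightarrow> 'a set \<Rightarrow> nat \<Rightarrow> 'a set" where
  "set_iter D \<sigma> Y n = (\<Inter>i\<le>n. preimg D \<sigma> i Y)"

definition covering_number :: "'a set set \<Rightarrow> 'a set \<Rightarrow> enat" where
  "covering_number \<alpha> Y =
     (if Y = {} then 1 else (INF \<beta>\<in>{\<beta>. \<beta> \<subseteq> \<alpha> \<and> Y \<subseteq> \<Union>\<beta>}. ecard \<beta>))"

definition cover_entropy :: "'a set set \<Rightarrow> 'a set \<Rightarrow> ereal" where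
  "cover_entropy \<alpha> Y = elog (covering_number \<alpha> Y)"

definition open_cover :: "'a::topological_space set set \<Rightarrow> 'a set \<Rightarrow> bool" where
  "open_cover \<alpha> Y \<longleftrightarrow> (\<forall>A\<in>\<alpha>. open A) \<and> Y \<subseteq> \<Union>\<alpha>"

definition top_entropy_cover :: "'a set set \<Rightarrow> 'a set \<Rightarrow> ('a \<Rightarrow> 'a) \<Rightarrow> 'a set \<Rightarrow> ereal" where
  "top_entropy_cover \<alpha> D \<sigma> K =
     lim (\<lambda>n. ereal (1 / real n) * cover_entropy (cover_iter D \<sigma> \<alpha> n) (set_iter D \<sigma> K n))"

definition top_entropy_on :: "'a::topological_space set \<Rightarrow> ('a \<Rightarrow> 'a) \<Rightarrow> 'a set \<Rightarrow> ereal" where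
  "top_entropy_on D \<sigma> K = (SUP \<alpha>\<in>{\<alpha>. open_cover \<alpha> K}. top_entropy_cover \<alpha> D \<sigma> K)"

definition top_entropy :: "'a::topological_space set \<Rightarrow> ('a \<Rightarrow> 'a) \<Rightarrow> ereal" where
  "top_entropy D \<sigma> = (SUP K\<in>{K. compact K}. top_entropy_on D \<sigma> K)"

end

theory Submission
  imports Defs
begin

text \<open>
  Let \<open>\<alpha>\<close> be an open cover of a compact set \<open>K\<close> and let \<open>2\<epsilon>\<close> be a Lebesgue number of it. A maximal
  \<open>(n + 1, \<epsilon>)\<close>-separated subset \<open>A\<close> of \<open>K\<^sub>n\<close> is also \<open>\<epsilon>\<close>-spanning, and each Bowen ball around a
  point of \<open>A\<close> lies in a member of \<open>\<alpha>\<^sub>n\<close>, so \<open>N(\<alpha>\<^sub>n, K\<^sub>n) \<le> |A|\<close>. The set \<open>K\<^sub>n\<close> need not be closed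
  in \<open>X\<close>, but a finite \<open>A\<close> is, so \<open>F = A\<close> is admissible in the supremum defining \<open>ssep\<close>. Hence
  \<open>N(\<alpha>\<^sub>n, K\<^sub>n) \<le> ssep(n + 1, \<epsilon>, \<sigma>, K)\<close>. The limit defining the entropy of \<open>\<alpha>\<close> exists by Fekete's
  lemma, as \<open>n \<mapsto> H(\<alpha>\<^bsub>n-1\<^esub>, K\<^bsub>n-1\<^esub>)\<close> is subadditive.
\<close>

section \<open>Fekete's lemma\<close>

text \<open>The quotients converge to their infimum \<open>L\<close> over n >= 1. Dividing n by a
  fixed m with remainder bounds b n / n by b m / m plus a term of order 1/n, and m is chosen with b
  m / m close to \<open>L\<close>.\<close>

lemma subadditive_quotient_convergent:
  fixes b :: "nat \<Rightarrow> real"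
  assumes sub: "\<And>m n. b (m + n) \<le> b m + b n" and nonneg: "\<And>n. 0 \<le> b n"
  obtains L where "(\<lambda>n. b n / real n) \<longlonglongrightarrow> L"
proof -
  define L where "L = (INF n\<in>{1..}. b n / real n)"
  have bdd: "bdd_below ((\<lambda>n. b n / real n) ` {1..})"
    by (rule bdd_belowI[of _ 0]) (auto simp: nonneg)
  have lower: "L \<le> b n / real n" if "n \<ge> 1" for n
    unfolding L_def using that by (intro cINF_lower bdd) auto
  have mult: "b (q * m + r) \<le> real q * b m + b r" for q m r
  proof (induction q)
    case (Suc q)
    have "b (Suc q * m + r) \<le> b m + b (q * m + r)"
      using sub[of m "q * m + r"] by (simp add: add.assoc)
    with Suc show ?case by (simp add: algebra_simps)
  qed simp
  have "(\<lambda>n. b n / real n) \<longlonglongrightarrow> L"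
  proof (rule order_tendstoI)
    fix a assume "a < L"
    with lower show "\<forall>\<^sub>F n in sequentially. a < b n / real n"
      by (intro eventually_sequentiallyI[of 1]) (meson less_le_trans)
  next
    fix a assume "L < a"
    then obtain m where m: "m \<ge> 1" "b m / real m < a"
      using bdd cINF_less_iff[of "{1::nat..}" "\<lambda>n. b n / real n" a] by (auto simp: L_def)
    \<comment> \<open>Bounds \<open>b\<close> at every remainder modulo m at once, because all terms
      are nonnegative.\<close>
    define C where "C = (\<Sum>r<m. b r)"
    have bound: "b n / real n \<le> b m / real m + C / real n" if "n \<ge> 1" for n
    proof -
      have "b (n mod m) \<le> C"
        unfolding C_def using m(1) by (intro member_le_sum) (auto simp: nonneg)
      moreover have "b n \<le> real (n div m) * b m + b (n mod m)"
        using mult[of "n div m" m "n mod m"] by simp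
      moreover have "real (n div m) * b m \<le> real n / real m * b m"
        by (intro mult_right_mono nonneg) (metis of_nat_div_le_of_nat)
      ultimately have "b n \<le> real n / real m * b m + C" by linarith
      then have "b n / real n \<le> (real n / real m * b m + C) / real n"
        by (intro divide_right_mono) auto
      also have "\<dots> = b m / real m + C / real n"
        using that m(1) by (simp add: field_simps)
      finally show ?thesis .
    qed
    have "(\<lambda>n. b m / real m + C / real n) \<longlonglongrightarrow> b m / real m + 0"
      by (intro tendsto_intros lim_const_over_n)
    then have "\<forall>\<^sub>F n in sequentially. b m / real m + C / real n < a"
      using m(2) by (auto dest: order_tendstoD)
    with eventually_ge_at_top[of 1] show "\<forall>\<^sub>F n in sequentially. b n / real n < a"
      by eventually_elim (use bound le_less_trans in blast)
  qed
  with that show thesis by blast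
qed

section \<open>Iterated domains, cylinders and iterated covers\<close>

lemma Dom_iter_add:
  "x \<in> Dom_iter D \<sigma> (m + n) \<longleftrightarrow> x \<in> Dom_iter D \<sigma> m \<and> (\<sigma> ^^ m) x \<in> Dom_iter D \<sigma> n"
  by (induction m arbitrary: x) (auto simp: funpow_swap1)

lemma Dom_iter_antimono: "i \<le> n \<Longrightarrow> Dom_iter D \<sigma> n \<subseteq> Dom_iter D \<sigma> i"
  by (metis Dom_iter_add le_Suc_ex subsetI)

lemma preimg_add: "preimg D \<sigma> (m + n) A = preimg D \<sigma> m (preimg D \<sigma> n A)"
proof -
  have "(\<sigma> ^^ (m + n)) x = (\<sigma> ^^ n) ((\<sigma> ^^ m) x)" for x
    by (simp add: add.commute[of m n] funpow_add)
  then show ?thesis by (auto simp: preimg_def Dom_iter_add)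
qed

text \<open>The points whose orbit stays defined up to time n and visits \<open>U 0\<close>, ...,
  \<open>U n\<close> in turn. A constant \<open>U\<close> gives K_n and sequences in \<alpha> give
  the members of \<alpha>_n, so one splitting rule serves both.\<close>

definition cylinder :: "'a set \<Rightarrow> ('a \<Rightarrow> 'a) \<Rightarrow> (nat \<Rightarrow> 'a set) \<Rightarrow> nat \<Rightarrow> 'a set" where
  "cylinder D \<sigma> U n = (\<Inter>i\<le>n. preimg D \<sigma> i (U i))"

lemma set_iter_eq_cylinder: "set_iter D \<sigma> K n = cylinder D \<sigma> (\<lambda>_. K) n"
  by (simp add: set_iter_def cylinder_def)

lemma set_iter_subset: "set_iter D \<sigma> K n \<subseteq> K \<inter> Dom_iter D \<sigma> n"
proof
  fix x assume "x \<in> set_iter D \<sigma> K n"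
  then have "x \<in> preimg D \<sigma> 0 K" "x \<in> preimg D \<sigma> n K"
    unfolding set_iter_def by blast+
  then show "x \<in> K \<inter> Dom_iter D \<sigma> n" by (simp add: preimg_def)
qed

lemma cylinder_cong: "(\<And>i. i \<le> n \<Longrightarrow> U i = V i) \<Longrightarrow> cylinder D \<sigma> U n = cylinder D \<sigma> V n"
  by (auto simp: cylinder_def)

lemma cylinder_0: "cylinder D \<sigma> U 0 = U 0"
  by (simp add: cylinder_def preimg_def)

lemma cylinder_Suc: "cylinder D \<sigma> U (Suc n) = cylinder D \<sigma> U n \<inter> preimg D \<sigma> (Suc n) (U (Suc n))"
  by (auto simp: cylinder_def atMost_Suc)

lemma preimg_Int: "preimg D \<sigma> i (A \<inter> B) = preimg D \<sigma> i A \<inter> preimg D \<sigma> i B"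
  by (auto simp: preimg_def)

text \<open>A cylinder of index n carries n + 1 conditions. Blocks of indices m and n therefore
  combine to index \<open>Suc (m + n)\<close>, and the second block starts at time
  \<open>Suc m\<close>.\<close>

lemma cylinder_add:
  "cylinder D \<sigma> U (Suc (m + n)) =
     cylinder D \<sigma> U m \<inter> preimg D \<sigma> (Suc m) (cylinder D \<sigma> (\<lambda>i. U (Suc m + i)) n)"
proof (induction n)
  case 0
  show ?case by (simp add: cylinder_Suc cylinder_0)
next
  case (Suc n)
  have "preimg D \<sigma> (Suc (Suc (m + n))) A = preimg D \<sigma> (Suc m) (preimg D \<sigma> (Suc n) A)" for A
    using preimg_add[of D \<sigma> "Suc m" "Suc n" A] by simp
  with Suc show ?case
    by (simp add: cylinder_Suc preimg_Int Int_assoc)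
qed

text \<open>Unfolds the recursive join into a choice of one member of \<alpha> per time, so that
  members of \<alpha>_n can be written down directly.\<close>

lemma cover_iter_eq_cylinders:
  "cover_iter D \<sigma> \<alpha> n = {cylinder D \<sigma> U n |U. \<forall>i\<le>n. U i \<in> \<alpha>}"
proof (induction n)
  case 0
  have "\<exists>U. B = cylinder D \<sigma> U 0 \<and> U 0 \<in> \<alpha>" if "B \<in> \<alpha>" for B
    using that by (intro exI[of _ "\<lambda>_. B"]) (simp add: cylinder_0)
  then show ?case by (auto simp: cylinder_0)
next
  case (Suc n)
  show ?case
  proof (intro equalityI subsetI)
    fix B assume "B \<in> cover_iter D \<sigma> \<alpha> (Suc n)"
    then obtain U V where U: "\<forall>i\<le>n. U i \<in> \<alpha>" and V: "V \<in> \<alpha>"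
      and B: "B = cylinder D \<sigma> U n \<inter> preimg D \<sigma> (Suc n) V"
      by (auto simp: Suc cover_join_def)
    \<comment> \<open>The cylinder of index n ignores \<open>U\<close> beyond n, so the new set can
      be stored at \<open>Suc n\<close>.\<close>
    have "cylinder D \<sigma> (U(Suc n := V)) n = cylinder D \<sigma> U n"
      by (rule cylinder_cong) simp
    then have "B = cylinder D \<sigma> (U(Suc n := V)) (Suc n)"
      by (simp add: cylinder_Suc B)
    with U V show "B \<in> {cylinder D \<sigma> U (Suc n) |U. \<forall>i\<le>Suc n. U i \<in> \<alpha>}"
      by (auto simp: le_Suc_eq intro!: exI[of _ "U(Suc n := V)"])
  next
    fix B assume "B \<in> {cylinder D \<sigma> U (Suc n) |U. \<forall>i\<le>Suc n. U i \<in> \<alpha>}"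
    then obtain U where U: "\<forall>i\<le>Suc n. U i \<in> \<alpha>"
      and B: "B = cylinder D \<sigma> U n \<inter> preimg D \<sigma> (Suc n) (U (Suc n))"
      by (auto simp: cylinder_Suc)
    from U have "cylinder D \<sigma> U n \<in> cover_iter D \<sigma> \<alpha> n"
      unfolding Suc by (auto intro: le_SucI)
    with U B show "B \<in> cover_iter D \<sigma> \<alpha> (Suc n)"
      by (auto simp: cover_join_def)
  qed
qed

text \<open>The sequences defining the two members are concatenated into \<open>W\<close>.\<close>

lemma cover_iter_add:
  assumes "A \<in> cover_iter D \<sigma> \<alpha> m" "B \<in> cover_iter D \<sigma> \<alpha> n"
  shows "A \<inter> preimg D \<sigma> (Suc m) B \<in> cover_iter D \<sigma> \<alpha> (Suc (m + n))"
proof -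
  obtain U V where U: "\<forall>i\<le>m. U i \<in> \<alpha>" "A = cylinder D \<sigma> U m"
    and V: "\<forall>i\<le>n. V i \<in> \<alpha>" "B = cylinder D \<sigma> V n"
    using assms by (auto simp: cover_iter_eq_cylinders)
  define W where "W i = (if i \<le> m then U i else V (i - Suc m))" for i
  have "cylinder D \<sigma> W m = A"
    unfolding U(2) by (intro cylinder_cong) (simp add: W_def)
  moreover have "cylinder D \<sigma> (\<lambda>i. W (Suc m + i)) n = B"
    unfolding V(2) by (intro cylinder_cong) (simp add: W_def)
  ultimately have "A \<inter> preimg D \<sigma> (Suc m) B = cylinder D \<sigma> W (Suc (m + n))"
    by (simp only: cylinder_add)
  moreover have "\<forall>i\<le>Suc (m + n). W i \<in> \<alpha>"
    using U V by (auto simp: W_def)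
  ultimately show ?thesis
    by (auto simp: cover_iter_eq_cylinders)
qed

lemma finite_cover_iter: "finite \<beta> \<Longrightarrow> finite (cover_iter D \<sigma> \<beta> n)"
proof (induction n)
  case (Suc n)
  have "cover_iter D \<sigma> \<beta> (Suc n) =
      (\<lambda>(A, B). A \<inter> B) ` (cover_iter D \<sigma> \<beta> n \<times> preimg D \<sigma> (Suc n) ` \<beta>)"
    by (auto simp: cover_join_def)
  with Suc show ?case by simp
qed simp

lemma cover_iter_covers:
  assumes "K \<subseteq> \<Union>\<beta>"
  shows "set_iter D \<sigma> K n \<subseteq> \<Union>(cover_iter D \<sigma> \<beta> n)"
proof
  fix x assume x: "x \<in> set_iter D \<sigma> K n"
  then have "\<forall>i\<in>{..n}. \<exists>B. B \<in> \<beta> \<and> (\<sigma> ^^ i) x \<in> B"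
    using assms by (fastforce simp: set_iter_def preimg_def)
  from bchoice[OF this] obtain U where U: "\<forall>i\<le>n. U i \<in> \<beta> \<and> (\<sigma> ^^ i) x \<in> U i"
    by auto
  with x have "x \<in> cylinder D \<sigma> U n"
    by (auto simp: cylinder_def set_iter_def preimg_def)
  moreover from U have "cylinder D \<sigma> U n \<in> cover_iter D \<sigma> \<beta> n"
    unfolding cover_iter_eq_cylinders by blast
  ultimately show "x \<in> \<Union>(cover_iter D \<sigma> \<beta> n)" by blast
qed

lemma cover_iter_mono: "\<beta> \<subseteq> \<alpha> \<Longrightarrow> cover_iter D \<sigma> \<beta> n \<subseteq> cover_iter D \<sigma> \<alpha> n"
  unfolding cover_iter_eq_cylinders by blast

section \<open>Covering numbers and the limit defining the entropy of a cover\<close>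

lemma covering_number_le:
  assumes "Y \<noteq> {}" "finite \<beta>" "\<beta> \<subseteq> \<alpha>" "Y \<subseteq> \<Union>\<beta>"
  shows "covering_number \<alpha> Y \<le> enat (card \<beta>)"
  using assms INF_lower[of \<beta> "{\<beta>. \<beta> \<subseteq> \<alpha> \<and> Y \<subseteq> \<Union>\<beta>}" ecard]
  by (simp add: covering_number_def ecard_def)

lemma covering_number_ge_1: "1 \<le> covering_number \<alpha> Y"
proof (cases "Y = {}")
  case False
  have "1 \<le> ecard \<beta>" if "Y \<subseteq> \<Union>\<beta>" for \<beta>
  proof -
    from False that have "\<beta> \<noteq> {}" by auto
    then show ?thesis by (auto simp: ecard_def one_enat_def Suc_le_eq card_gt_0_iff)
  qed
  with False show ?thesis by (auto simp: covering_number_def intro!: INF_greatest)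
qed (simp add: covering_number_def)

text \<open>\<open>enat\<close> is well ordered, so the infimum of a nonempty set belongs to it. For
  empty \<open>Y\<close> the value 1 is a convention and need not be the size of a subcover.\<close>

lemma covering_number_attained:
  assumes "covering_number \<alpha> Y = enat k" "Y \<noteq> {}"
  obtains \<beta> where "finite \<beta>" "\<beta> \<subseteq> \<alpha>" "Y \<subseteq> \<Union>\<beta>" "card \<beta> = k"
proof -
  let ?S = "ecard ` {\<beta>. \<beta> \<subseteq> \<alpha> \<and> Y \<subseteq> \<Union>\<beta>}"
  have Inf: "Inf ?S = enat k" using assms by (simp add: covering_number_def)
  \<comment> \<open>The infimum of the empty set is \<infinity> in \<open>enat\<close>, so a finite
    value guarantees that some subfamily covers \<open>Y\<close>.\<close>
  then have "?S \<noteq> {}" by (metis Inf_enat_def enat.distinct(1))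
  then obtain N where "N \<in> ?S" by blast
  then have "Inf ?S \<in> ?S" by (rule wellorder_InfI)
  with Inf obtain \<beta> where "\<beta> \<subseteq> \<alpha>" "Y \<subseteq> \<Union>\<beta>" "ecard \<beta> = enat k" by auto
  then show thesis by (intro that[of \<beta>]) (auto simp: ecard_def split: if_splits)
qed

text \<open>Submultiplicativity: minimal subcovers for K_m and K_n are combined pairwise by
  \<open>A \<inter> preimg D \<sigma> (Suc m) B\<close>, which gives at most p * q sets.\<close>

lemma covering_number_cover_iter_add:
  assumes "covering_number (cover_iter D \<sigma> \<alpha> m) (set_iter D \<sigma> K m) = enat p"
    and "covering_number (cover_iter D \<sigma> \<alpha> n) (set_iter D \<sigma> K n) = enat q"
  shows "covering_number (cover_iter D \<sigma> \<alpha> (Suc (m + n))) (set_iter D \<sigma> K (Suc (m + n)))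
           \<le> enat (p * q)"
proof (cases "set_iter D \<sigma> K (Suc (m + n)) = {}")
  case True
  \<comment> \<open>The empty set has covering number 1, so it is enough that p and q are
    positive.\<close>
  have "1 \<le> p" "1 \<le> q"
    using covering_number_ge_1 assms by (metis enat_ord_simps(1) one_enat_def)+
  with True show ?thesis
    by (simp add: covering_number_def one_enat_def Suc_le_eq)
next
  case False
  have split: "set_iter D \<sigma> K (Suc (m + n)) =
      set_iter D \<sigma> K m \<inter> preimg D \<sigma> (Suc m) (set_iter D \<sigma> K n)"
    by (simp only: set_iter_eq_cylinder cylinder_add)
  with False have "set_iter D \<sigma> K m \<noteq> {}" "set_iter D \<sigma> K n \<noteq> {}"
    by (auto simp: preimg_def)
  then obtain \<beta> \<gamma> where
    \<beta>: "finite \<beta>" "\<beta> \<subseteq> cover_iter D \<sigma> \<alpha> m" "set_iter D \<sigma> K m \<subseteq> \<Union>\<beta>" "card \<beta> = p" and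
    \<gamma>: "finite \<gamma>" "\<gamma> \<subseteq> cover_iter D \<sigma> \<alpha> n" "set_iter D \<sigma> K n \<subseteq> \<Union>\<gamma>" "card \<gamma> = q"
    using assms by (metis covering_number_attained)
  define \<delta> where "\<delta> = (\<lambda>(A, B). A \<inter> preimg D \<sigma> (Suc m) B) ` (\<beta> \<times> \<gamma>)"
  have "finite \<delta>" using \<beta> \<gamma> by (simp add: \<delta>_def)
  moreover have "\<delta> \<subseteq> cover_iter D \<sigma> \<alpha> (Suc (m + n))"
    unfolding \<delta>_def using \<beta>(2) \<gamma>(2) cover_iter_add by fast
  moreover have "set_iter D \<sigma> K (Suc (m + n)) \<subseteq> \<Union>\<delta>"
    unfolding split \<delta>_def using \<beta>(3) \<gamma>(3) by (fastforce simp: preimg_def)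
  ultimately have "covering_number (cover_iter D \<sigma> \<alpha> (Suc (m + n)))
      (set_iter D \<sigma> K (Suc (m + n))) \<le> enat (card \<delta>)"
    using False by (intro covering_number_le)
  also have "card \<delta> \<le> p * q"
    unfolding \<delta>_def using \<beta> \<gamma> by (metis card_cartesian_product card_image_le finite_cartesian_product)
  finally show ?thesis by simp
qed

text \<open>Compactness is applied to \<open>K\<close>, since K_n itself need not be compact: the
  iterated join of a finite subcover of \<open>K\<close> is still finite and covers K_n.\<close>

lemma covering_number_cover_iter_finite:
  assumes "compact K" "open_cover \<alpha> K"
  obtains k where "covering_number (cover_iter D \<sigma> \<alpha> n) (set_iter D \<sigma> K n) = enat k" "1 \<le> k"
proof -
  obtain \<beta> where \<beta>: "\<beta> \<subseteq> \<alpha>" "finite \<beta>" "K \<subseteq> \<Union>\<beta>"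
    using assms unfolding open_cover_def by (meson compactE)
  have "covering_number (cover_iter D \<sigma> \<alpha> n) (set_iter D \<sigma> K n) \<noteq> \<infinity>"
  proof (cases "set_iter D \<sigma> K n = {}")
    case False
    then have "covering_number (cover_iter D \<sigma> \<alpha> n) (set_iter D \<sigma> K n)
        \<le> enat (card (cover_iter D \<sigma> \<beta> n))"
      using \<beta> by (intro covering_number_le finite_cover_iter cover_iter_mono cover_iter_covers)
    then show ?thesis by (cases "covering_number (cover_iter D \<sigma> \<alpha> n) (set_iter D \<sigma> K n)") auto
  qed (simp add: covering_number_def one_enat_def)
  then obtain k where "covering_number (cover_iter D \<sigma> \<alpha> n) (set_iter D \<sigma> K n) = enat k"
    by auto
  moreover from this have "1 \<le> k"
    by (metis covering_number_ge_1 enat_ord_simps(1) one_enat_def)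
  ultimately show thesis by (rule that)
qed

lemma elog_mono: "M \<le> N \<Longrightarrow> elog M \<le> elog N"
  by (cases M; cases N) (auto simp: elog_def)

text \<open>\<open>top_entropy_cover\<close> is defined through \<open>lim\<close>, so its value is
  accessible only once convergence is known. The factor 1/(n + 1) is the one that later matches
  \<open>ssep\<close> at \<open>Suc n\<close>.\<close>

lemma cover_entropy_limit:
  assumes "compact K" "open_cover \<alpha> K"
  obtains L where
    "(\<lambda>n. ereal (1 / real (Suc n)) * cover_entropy (cover_iter D \<sigma> \<alpha> n) (set_iter D \<sigma> K n))
       \<longlonglongrightarrow> L"
    "top_entropy_cover \<alpha> D \<sigma> K = L"
proof -
  obtain N where
    N: "\<And>n. covering_number (cover_iter D \<sigma> \<alpha> n) (set_iter D \<sigma> K n) = enat (N n)"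
       "\<And>n. 1 \<le> N n"
  proof -
    have "\<exists>k. covering_number (cover_iter D \<sigma> \<alpha> n) (set_iter D \<sigma> K n) = enat k \<and> 1 \<le> k" for n
      using covering_number_cover_iter_finite[OF assms] by blast
    with that show thesis by metis
  qed
  have H: "cover_entropy (cover_iter D \<sigma> \<alpha> n) (set_iter D \<sigma> K n) = ereal (ln (real (N n)))" for n
    using N(2)[of n] by (simp add: cover_entropy_def elog_def N(1))
  \<comment> \<open>The shift by one turns the bound at \<open>Suc (m + n)\<close> into plain
    subadditivity; the value 0 at n = 0 settles the cases where m or n is 0.\<close>
  define b where "b n = (if n = 0 then 0 else ln (real (N (n - 1))))" for n
  have "N (Suc (m + n)) \<le> N m * N n" for m n
    using covering_number_cover_iter_add[OF N(1)[of m] N(1)[of n]]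
    by (simp only: N(1) enat_ord_simps)
  then have sub: "ln (real (N (Suc (m + n)))) \<le> ln (real (N m)) + ln (real (N n))" for m n
  proof -
    have pos: "0 < N k" for k using N(2)[of k] by linarith
    have "ln (real (N (Suc (m + n)))) \<le> ln (real (N m * N n))"
      using pos \<open>N (Suc (m + n)) \<le> N m * N n\<close> by (subst ln_le_cancel_iff) (auto simp flip: of_nat_mult)
    then show ?thesis using pos by (simp add: ln_mult)
  qed
  have "b (m + n) \<le> b m + b n" for m n
    using sub[of "m - 1" "n - 1"] by (cases m; cases n) (auto simp: b_def)
  moreover have "0 \<le> b n" for n
    using N(2)[of "n - 1"] by (simp add: b_def)
  ultimately obtain L where "(\<lambda>n. b n / real n) \<longlonglongrightarrow> L"
    by (rule subadditive_quotient_convergent)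
  then have L: "(\<lambda>n. ln (real (N n)) / real (Suc n)) \<longlonglongrightarrow> L"
    by (subst (asm) filterlim_sequentially_Suc[symmetric]) (simp add: b_def)
  \<comment> \<open>This ratio exchanges the factor 1/(n + 1) for the factor 1/n of the
    definition.\<close>
  moreover have "(\<lambda>n. real (Suc n) / real n) \<longlonglongrightarrow> 1"
    by (rule LIMSEQ_Suc_n_over_n)
  ultimately have "(\<lambda>n. ln (real (N n)) / real (Suc n) * (real (Suc n) / real n)) \<longlonglongrightarrow> L * 1"
    by (rule tendsto_mult)
  then have "(\<lambda>n. ln (real (N n)) / real n) \<longlonglongrightarrow> L"
    by simp
  then have "top_entropy_cover \<alpha> D \<sigma> K = ereal L"
    unfolding top_entropy_cover_def by (intro limI) (simp add: H)
  with L show thesis by (intro that[of "ereal L"]) (simp_all add: H)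
qed

section \<open>Separated sets and the comparison with covering numbers\<close>

text \<open>The iterated domains decrease, so on the n-th one every time up to n is admissible and
  the maximum runs over \<open>{..n}\<close>.\<close>

lemma dist_n_le_iff:
  assumes "x \<in> Dom_iter D \<sigma> n" "y \<in> Dom_iter D \<sigma> n"
  shows "dist_n D \<sigma> (Suc n) x y \<le> \<epsilon> \<longleftrightarrow> (\<forall>i\<le>n. dist ((\<sigma> ^^ i) x) ((\<sigma> ^^ i) y) \<le> \<epsilon>)"
proof -
  have "I_set D \<sigma> (Suc n) z = {..n}" if "z \<in> Dom_iter D \<sigma> n" for z
    using that Dom_iter_antimono[of _ n D \<sigma>] by (auto simp: I_set_def)
  with assms show ?thesis by (auto simp: dist_n_def)
qed

lemma dist_n_commute: "dist_n D \<sigma> n x y = dist_n D \<sigma> n y x"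
  by (simp add: dist_n_def dist_commute Int_commute)

text \<open>Chooses \<open>F = A\<close> in the supremum; at index \<open>Suc n\<close> the domain
  condition on \<open>F\<close> refers to \<open>Dom_iter D \<sigma> n\<close>.\<close>

lemma card_separated_le_ssep:
  assumes "finite A" "A \<subseteq> K \<inter> Dom_iter D \<sigma> n" "separated_set D \<sigma> (Suc n) \<epsilon> A A"
  shows "enat (card A) \<le> ssep D \<sigma> (Suc n) \<epsilon> K"
proof -
  have "enat (card A) = ecard A" using assms by (simp add: ecard_def)
  also have "\<dots> \<le> sep D \<sigma> (Suc n) \<epsilon> (K \<inter> A)"
    unfolding sep_def using assms by (intro SUP_upper) (auto simp: separated_set_def)
  also have "\<dots> \<le> ssep D \<sigma> (Suc n) \<epsilon> K"
    unfolding ssep_def using assms by (intro SUP_upper) (auto simp: finite_imp_closed)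
  finally show ?thesis .
qed

text \<open>A finite \<open>ssep\<close> bounds the size of all finite separated subsets of
  \<open>Z\<close>, so a largest one exists. A point far from all its elements could be added to
  it.\<close>

lemma maximal_separated_set:
  assumes "Z \<subseteq> K \<inter> Dom_iter D \<sigma> n" "ssep D \<sigma> (Suc n) \<epsilon> K = enat k"
  obtains A where "finite A" "A \<subseteq> Z" "card A \<le> k"
    "\<And>z. z \<in> Z \<Longrightarrow> z \<notin> A \<Longrightarrow> \<exists>a\<in>A. dist_n D \<sigma> (Suc n) a z \<le> \<epsilon>"
proof -
  let ?P = "\<lambda>A. finite A \<and> separated_set D \<sigma> (Suc n) \<epsilon> Z A"
  have le_k: "card A \<le> k" if "?P A" for A
  proof -
    have "A \<subseteq> K \<inter> Dom_iter D \<sigma> n" "separated_set D \<sigma> (Suc n) \<epsilon> A A"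
      using that assms(1) by (auto simp: separated_set_def)
    with that assms(2) show ?thesis
      using card_separated_le_ssep[of A K D \<sigma> n \<epsilon>] by simp
  qed
  have "?P {}" by (simp add: separated_set_def)
  moreover have "\<forall>A. ?P A \<longrightarrow> card A < Suc k" using le_k by (simp add: less_Suc_eq_le)
  ultimately obtain A where A: "?P A" and max: "\<And>B. ?P B \<Longrightarrow> card B \<le> card A"
    using Lattices_Big.ex_has_greatest_nat[of ?P "{}" card "Suc k"] by blast
  have "\<exists>a\<in>A. dist_n D \<sigma> (Suc n) a z \<le> \<epsilon>" if z: "z \<in> Z" "z \<notin> A" for z
  proof (rule ccontr)
    assume "\<not> ?thesis"
    then have far: "\<epsilon> < dist_n D \<sigma> (Suc n) a z" "\<epsilon> < dist_n D \<sigma> (Suc n) z a" if "a \<in> A" for a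
      using that by (auto simp: not_le dist_n_commute[of D \<sigma> "Suc n" z])
    with A z have "?P (insert z A)" by (auto simp: separated_set_def)
    then have "card (insert z A) \<le> card A" by (rule max)
    with A z show False by simp
  qed
  with A le_k show thesis by (intro that[of A]) (auto simp: separated_set_def)
qed

text \<open>Each point of a maximal separated set selects one member of \<alpha>_n, and these
  members cover K_n. The scale \<open>e / 2\<close> leaves room for the strict inequality in the
  open balls of radius \<open>e\<close>.\<close>

lemma elog_covering_number_le_ssep:
  assumes "0 < e" and lebesgue: "\<And>x. x \<in> K \<Longrightarrow> \<exists>G\<in>\<alpha>. ball x e \<subseteq> G"
  shows "elog (covering_number (cover_iter D \<sigma> \<alpha> n) (set_iter D \<sigma> K n))
           \<le> elog (ssep D \<sigma> (Suc n) (e / 2) K)"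
proof (cases "ssep D \<sigma> (Suc n) (e / 2) K")
  case (enat k)
  let ?Z = "set_iter D \<sigma> K n"
  show ?thesis
  proof (cases "?Z = {}")
    case True
    \<comment> \<open>The left side is log 1 = 0, and \<open>elog\<close> is nonnegative even at
      0.\<close>
    then show ?thesis by (auto simp: covering_number_def elog_def enat one_enat_def)
  next
    case False
    obtain A where A: "finite A" "A \<subseteq> ?Z" "card A \<le> k"
      and near: "\<And>z. z \<in> ?Z \<Longrightarrow> z \<notin> A \<Longrightarrow> \<exists>a\<in>A. dist_n D \<sigma> (Suc n) a z \<le> e / 2"
      using maximal_separated_set[OF set_iter_subset enat] by blast
    \<comment> \<open>Points of K_n stay in \<open>K\<close> up to time n, so the Lebesgue property
      applies along the whole orbit of \<open>a\<close>.\<close>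
    have "\<exists>U\<in>\<alpha>. ball ((\<sigma> ^^ i) a) e \<subseteq> U" if "a \<in> A" "i \<le> n" for a i
      using that A(2) by (intro lebesgue) (auto simp: set_iter_def preimg_def)
    then obtain U where U: "\<And>a i. a \<in> A \<Longrightarrow> i \<le> n \<Longrightarrow> U a i \<in> \<alpha> \<and> ball ((\<sigma> ^^ i) a) e \<subseteq> U a i"
      by metis
    define \<beta> where "\<beta> = (\<lambda>a. cylinder D \<sigma> (U a) n) ` A"
    have "?Z \<subseteq> \<Union>\<beta>"
    proof
      fix z assume z: "z \<in> ?Z"
      have dom: "x \<in> Dom_iter D \<sigma> n" if "x \<in> ?Z" for x
        using that set_iter_subset[of D \<sigma> K n] by auto
      obtain a where a: "a \<in> A" "\<forall>i\<le>n. dist ((\<sigma> ^^ i) a) ((\<sigma> ^^ i) z) \<le> e / 2"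
      proof (cases "z \<in> A")
        case True
        \<comment> \<open>\<open>near\<close> says nothing about points of \<open>A\<close>; such a
          point serves as its own centre.\<close>
        with \<open>0 < e\<close> show ?thesis by (intro that[of z]) simp_all
      next
        case False
        with near z obtain a where "a \<in> A" "dist_n D \<sigma> (Suc n) a z \<le> e / 2" by blast
        moreover from this z A(2) have "a \<in> Dom_iter D \<sigma> n" "z \<in> Dom_iter D \<sigma> n"
          using dom by blast+
        ultimately show ?thesis by (metis dist_n_le_iff that)
      qed
      have "(\<sigma> ^^ i) z \<in> U a i" if "i \<le> n" for i
      proof -
        have "dist ((\<sigma> ^^ i) a) ((\<sigma> ^^ i) z) < e"
          using a(2) that \<open>0 < e\<close> by fastforce
        with U[OF a(1) that] show ?thesis by auto
      qed
      with z have "z \<in> cylinder D \<sigma> (U a) n"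
        by (auto simp: cylinder_def set_iter_def preimg_def)
      with a(1) show "z \<in> \<Union>\<beta>" by (auto simp: \<beta>_def)
    qed
    moreover have "\<beta> \<subseteq> cover_iter D \<sigma> \<alpha> n"
      using U by (auto simp: \<beta>_def cover_iter_eq_cylinders)
    ultimately have "covering_number (cover_iter D \<sigma> \<alpha> n) ?Z \<le> enat (card \<beta>)"
      using False A(1) by (intro covering_number_le) (auto simp: \<beta>_def)
    also have "card \<beta> \<le> k"
      using A card_image_le[of A] by (fastforce simp: \<beta>_def intro: order_trans)
    finally show ?thesis by (intro elog_mono) (simp add: enat)
  qed
qed (simp add: elog_def)

section \<open>The limit in \<epsilon> and the final comparison\<close>

lemma ssep_antimono: "\<delta> \<le> \<epsilon> \<Longrightarrow> ssep D \<sigma> n \<epsilon> K \<le> ssep D \<sigma> n \<delta> K"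
  unfolding ssep_def sep_def
  by (intro SUP_subset_mono order_refl) (force simp: separated_set_def)

lemma metric_entropy_eps_antimono:
  "\<delta> \<le> \<epsilon> \<Longrightarrow> metric_entropy_eps D \<sigma> \<epsilon> K \<le> metric_entropy_eps D \<sigma> \<delta> K"
  unfolding metric_entropy_eps_def
  by (intro Limsup_mono always_eventually allI ereal_mult_left_mono elog_mono ssep_antimono) auto

text \<open>An antitone function rises to its supremum as the argument decreases to a; this supplies
  the limit as \<epsilon> tends to 0.\<close>

lemma tendsto_at_right_SUP:
  fixes f :: "real \<Rightarrow> 'b::{complete_linorder,linorder_topology}"
  assumes "\<And>x y. x \<le> y \<Longrightarrow> f y \<le> f x"
  shows "(f \<longlongrightarrow> (SUP x\<in>{a<..}. f x)) (at_right a)"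
proof (rule order_tendstoI)
  fix c assume "c < (SUP x\<in>{a<..}. f x)"
  then obtain y where y: "y > a" "c < f y" by (auto simp: less_SUP_iff)
  then show "\<forall>\<^sub>F x in at_right a. c < f x"
    unfolding eventually_at_right_field using assms by (meson less_imp_le less_le_trans)
next
  fix c assume c: "(SUP x\<in>{a<..}. f x) < c"
  have "f x < c" if "x > a" for x
    using c that by (meson SUP_upper greaterThan_iff le_less_trans)
  then show "\<forall>\<^sub>F x in at_right a. f x < c"
    by (auto simp: eventually_at_right_field intro: gt_ex)
qed

text \<open>By monotonicity the \<open>Lim\<close> is a supremum over positive \<epsilon>, so any
  single scale gives a lower bound.\<close>

lemma metric_entropy_eps_le_metric_entropy_on:
  assumes "0 < \<epsilon>"
  shows "metric_entropy_eps D \<sigma> \<epsilon> K \<le> metric_entropy_on D \<sigma> K"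
proof -
  have "((\<lambda>\<epsilon>. metric_entropy_eps D \<sigma> \<epsilon> K) \<longlongrightarrow> (SUP \<epsilon>\<in>{0<..}. metric_entropy_eps D \<sigma> \<epsilon> K))
      (at_right 0)"
    by (intro tendsto_at_right_SUP metric_entropy_eps_antimono)
  then have "metric_entropy_on D \<sigma> K = (SUP \<epsilon>\<in>{0<..}. metric_entropy_eps D \<sigma> \<epsilon> K)"
    unfolding metric_entropy_on_def by (intro tendsto_Lim) auto
  with assms show ?thesis by (auto intro: SUP_upper)
qed

lemma top_entropy_cover_le_metric_entropy_on:
  assumes "compact K" "open_cover \<alpha> K"
  shows "top_entropy_cover \<alpha> D \<sigma> K \<le> metric_entropy_on D \<sigma> K"
proof -
  \<comment> \<open>A Lebesgue number from compactness of \<open>K\<close>; separation is then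
    measured at half of it.\<close>
  obtain e where e: "0 < e" "\<And>x. x \<in> K \<Longrightarrow> \<exists>G\<in>\<alpha>. ball x e \<subseteq> G"
    using Heine_Borel_lemma[OF assms(1), of \<alpha>] assms(2) unfolding open_cover_def by metis
  obtain L where
    L: "(\<lambda>n. ereal (1 / real (Suc n)) * cover_entropy (cover_iter D \<sigma> \<alpha> n) (set_iter D \<sigma> K n))
          \<longlonglongrightarrow> L" "top_entropy_cover \<alpha> D \<sigma> K = L"
    using cover_entropy_limit[OF assms] by blast
  let ?s = "\<lambda>n. ereal (1 / real n) * elog (ssep D \<sigma> n (e / 2) K)"
  have "L = limsup (\<lambda>n. ereal (1 / real (Suc n)) *
      cover_entropy (cover_iter D \<sigma> \<alpha> n) (set_iter D \<sigma> K n))"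
    using L(1) by (intro lim_imp_Limsup[symmetric]) auto
  also have "\<dots> \<le> limsup (\<lambda>n. ?s (Suc n))"
    unfolding cover_entropy_def using e
    by (intro Limsup_mono always_eventually allI ereal_mult_left_mono
        elog_covering_number_le_ssep) auto
  \<comment> \<open>A limsup ignores an index shift, which absorbs the offset between \<alpha>_n and
    \<open>ssep\<close> at \<open>Suc n\<close>.\<close>
  also have "\<dots> = metric_entropy_eps D \<sigma> (e / 2) K"
    unfolding metric_entropy_eps_def using limsup_shift[of ?s] by simp
  also have "\<dots> \<le> metric_entropy_on D \<sigma> K"
    using e(1) by (intro metric_entropy_eps_le_metric_entropy_on) simp
  finally show ?thesis by (simp add: L(2))
qed

theorem theorem6p18:
  fixes D :: "'a::metric_space set" and \<sigma> :: "'a \<Rightarrow> 'a"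
  assumes "deaconu_renault D \<sigma>"
  shows "top_entropy D \<sigma> \<le> metric_entropy D \<sigma>"
  unfolding top_entropy_def metric_entropy_def top_entropy_on_def
  by (intro SUP_mono) (auto intro!: SUP_least top_entropy_cover_le_metric_entropy_on)

end
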